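(* $[\mathcal{H}_{\mathrm{ferro}}]_3=[\mathcal{I}_{\mathrm{ferro}}]_3$.
   Context: $\mathcal{B}_k$ is the set of functions $\{0,1\}^k\to\mathbb{R}_{\ge0}$, $\mathcal{B}=\bigcup_k\mathcal{B}_k$, and $[\mathcal{F}]_3=\mathcal{F}\cap\mathcal{B}_3$. $\mathrm{EQ}$ is the binary equality indicator. $\langle\mathcal{F}\rangle$ is the closure of $\mathcal{F}\cup\{\mathrm{EQ}\}$ under introducing fictitious arguments, permuting arguments, pointwise product of equal-arity functions, and summing out an argument over $\{0,1\}$; a $k$-ary $f$ is a limit of $\mathcal{F}$ if there is a finite $S\subseteq\mathcal{F}$ such that for all $\epsilon>0$ some $k$-ary $f_\epsilon\in\langle S\rangle$ has $\max_\mathbf{x}|f-f_\epsilon|<\epsilon$; $\langle\mathcal{F}\rangle_\omega$ is the closure of $\mathcal{F}\cup\{\mathrm{EQ}\}$ under the four operations and limits. $\mathrm{Ising}_k^\lambda\in\mathcal{B}_k$ ($\lambda\ge0$) is 1 on the all-0 and all-1 tuples and $\lambda$ elsewhere. $\mathcal{I}_{\mathrm{ferro}}=\langle\{\mathrm{Ising}_2^\lambda:0\le\lambda\le1\}\cup\mathcal{B}_0\rangle_\omega$ and $\mathcal{H}_{\mathrm{ferro}}=\langle\{\mathrm{Ising}_k^\lambda:k\ge2,0\le\lambda\le1\}\cup\mathcal{B}_0\rangle_\omega$. *)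

theory Defs
  imports Complex_Main "HOL-Library.FuncSet" "HOL-Combinatorics.Permutations"
begin

text \<open>Arguments in \<open>{0,1}\<close> are represented by \<^typ>\<open>bool\<close>
  (0 is \<^term>\<open>False\<close>, 1 is \<^term>\<open>True\<close>).\<close>

definition tuples :: "nat \<Rightarrow> bool list set" where
  "tuples k = {x. length x = k}"

text \<open>A \<open>k\<close>-ary function is a pair of its arity and an extensional function on
  \<open>tuples k\<close>. Recording the arity keeps \<open>\<B>_k\<close> and \<open>\<B>_l\<close> disjoint for distinct
  \<open>k, l\<close> (the value outside \<open>tuples k\<close> being unspecified, the function alone does not
  determine it).\<close>

type_synonym bfun = "nat \<times> (bool list \<Rightarrow> real)"

definition Bk :: "nat \<Rightarrow> bfun set" where
  "Bk k = {k} \<times> (tuples k \<rightarrow>\<^sub>E {0..})"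

definition ternary_part :: "bfun set \<Rightarrow> bfun set" where
  "ternary_part F = F \<inter> Bk 3"

definition EQ :: bfun where
  "EQ = (2, \<lambda>x\<in>tuples 2. if x ! 0 = x ! 1 then 1 else 0)"

text \<open>The four operations. The new or summed argument may be in any position
  \<open>i\<close> (counted from 0).\<close>

definition add_fictitious :: "nat \<Rightarrow> nat \<Rightarrow> (bool list \<Rightarrow> real) \<Rightarrow> bfun" where
  "add_fictitious k i f = (Suc k, \<lambda>x\<in>tuples (Suc k). f (take i x @ drop (Suc i) x))"

definition permute_args :: "nat \<Rightarrow> (nat \<Rightarrow> nat) \<Rightarrow> (bool list \<Rightarrow> real) \<Rightarrow> bfun" where
  "permute_args k p f = (k, \<lambda>x\<in>tuples k. f (permute_list p x))"

definition product :: "nat \<Rightarrow> (bool list \<Rightarrow> real) \<Rightarrow> (bool list \<Rightarrow> real) \<Rightarrow> bfun" where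
  "product k f g = (k, \<lambda>x\<in>tuples k. f x * g x)"

definition sum_out :: "nat \<Rightarrow> nat \<Rightarrow> (bool list \<Rightarrow> real) \<Rightarrow> bfun" where
  "sum_out k i f = (k, \<lambda>x\<in>tuples k. \<Sum>b\<in>{False, True}. f (take i x @ b # drop i x))"

inductive_set clone :: "bfun set \<Rightarrow> bfun set" for F where
  base: "f \<in> F \<Longrightarrow> f \<in> clone F"
| EQ: "EQ \<in> clone F"
| fictitious: "(k, f) \<in> clone F \<Longrightarrow> i \<le> k \<Longrightarrow> add_fictitious k i f \<in> clone F"
| permute: "(k, f) \<in> clone F \<Longrightarrow> p permutes {..<k} \<Longrightarrow> permute_args k p f \<in> clone F"
| product: "(k, f) \<in> clone F \<Longrightarrow> (k, g) \<in> clone F \<Longrightarrow> product k f g \<in> clone F"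
| sum_out: "(Suc k, f) \<in> clone F \<Longrightarrow> i \<le> k \<Longrightarrow> sum_out k i f \<in> clone F"

definition is_limit :: "bfun set \<Rightarrow> nat \<Rightarrow> (bool list \<Rightarrow> real) \<Rightarrow> bool" where
  "is_limit F k f \<longleftrightarrow> (k, f) \<in> Bk k \<and>
     (\<exists>S. finite S \<and> S \<subseteq> F \<and>
       (\<forall>\<epsilon>>0. \<exists>g. (k, g) \<in> clone S \<and> Max ((\<lambda>x. \<bar>f x - g x\<bar>) ` tuples k) < \<epsilon>))"

lemma is_limit_mono:
  assumes "F \<subseteq> G" "is_limit F k f"
  shows "is_limit G k f"
  using assms unfolding is_limit_def by (blast intro: subset_trans)

lemma is_limit_mono' [mono]:
  assumes "\<And>z. P z \<longrightarrow> Q z"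
  shows "is_limit {z. P z} k f \<longrightarrow> is_limit {z. Q z} k f"
  using is_limit_mono[of "Collect P" "Collect Q"] assms by blast

inductive_set omega_clone :: "bfun set \<Rightarrow> bfun set" for F where
  base: "f \<in> F \<Longrightarrow> f \<in> omega_clone F"
| EQ: "EQ \<in> omega_clone F"
| fictitious:
    "(k, f) \<in> omega_clone F \<Longrightarrow> i \<le> k \<Longrightarrow> add_fictitious k i f \<in> omega_clone F"
| permute:
    "(k, f) \<in> omega_clone F \<Longrightarrow> p permutes {..<k} \<Longrightarrow> permute_args k p f \<in> omega_clone F"
| product:
    "(k, f) \<in> omega_clone F \<Longrightarrow> (k, g) \<in> omega_clone F \<Longrightarrow> product k f g \<in> omega_clone F"
| sum_out:
    "(Suc k, f) \<in> omega_clone F \<Longrightarrow> i \<le> k \<Longrightarrow> sum_out k i f \<in> omega_clone F"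
| limit: "is_limit (omega_clone F) k f \<Longrightarrow> (k, f) \<in> omega_clone F"

definition Ising :: "nat \<Rightarrow> real \<Rightarrow> bfun" where
  "Ising k c = (k, \<lambda>x\<in>tuples k. if x = replicate k False \<or> x = replicate k True then 1 else c)"

definition I_ferro :: "bfun set" where
  "I_ferro = omega_clone ({Ising 2 c | c. 0 \<le> c \<and> c \<le> 1} \<union> Bk 0)"

definition H_ferro :: "bfun set" where
  "H_ferro = omega_clone ({Ising k c | k c. 2 \<le> k \<and> 0 \<le> c \<and> c \<le> 1} \<union> Bk 0)"

end

theory Submission
  imports Defs
begin

text \<open>Every function in \<^const>\<open>H_ferro\<close> is invariant under complementing all arguments and
  log-supermodular: the generators have these properties, and all operations, including limits,
  preserve them. A ternary function of this kind is determined by its values \<open>a, b, c, d\<close> at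
  \<open>000, 100, 010, 001\<close>, and log-supermodularity says precisely that the system
  \<open>b = a u v, c = a u w, d = a v w\<close> has a solution in \<open>[0,1]\<close> (generically
  \<open>u\<^sup>2 = b c / (a d)\<close>, and so on), so the function is \<open>a\<close> times a product of three binary
  Ising functions.\<close>

section \<open>The invariant class\<close>

definition lsm_self_dual :: "bfun set" where
  "lsm_self_dual = {(k, f). \<forall>x\<in>tuples k. 0 \<le> f x \<and> f (map Not x) = f x \<and>
     (\<forall>y\<in>tuples k. f x * f y \<le> f (map2 (\<and>) x y) * f (map2 (\<or>) x y))}"

lemma lsm_self_dualI:
  assumes "\<And>x. length x = k \<Longrightarrow> 0 \<le> f x"
    and "\<And>x. length x = k \<Longrightarrow> f (map Not x) = f x"
    and "\<And>x y. length x = k \<Longrightarrow> length y = k \<Longrightarrow>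
      f x * f y \<le> f (map2 (\<and>) x y) * f (map2 (\<or>) x y)"
  shows "(k, f) \<in> lsm_self_dual"
  using assms by (simp add: lsm_self_dual_def tuples_def)

lemma lsm_self_dualD:
  assumes "(k, f) \<in> lsm_self_dual" "length x = k"
  shows "0 \<le> f x" "f (map Not x) = f x"
    and "length y = k \<Longrightarrow> f x * f y \<le> f (map2 (\<and>) x y) * f (map2 (\<or>) x y)"
  using assms by (simp_all add: lsm_self_dual_def tuples_def)

section \<open>Closure under the four operations\<close>

lemma map2_delete:
  assumes "length x = length y"
  shows "take i (map2 h x y) @ drop (Suc i) (map2 h x y) =
    map2 h (take i x @ drop (Suc i) x) (take i y @ drop (Suc i) y)"
  using assms by (simp add: take_map drop_map take_zip drop_zip)

text \<open>The inserted bits are combined by \<open>h\<close> as well; in \<open>sum_out\<close>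
  this decides which summand of the meet and of the join a product is compared with.\<close>

lemma map2_insert:
  assumes "length x = length y"
  shows "map2 h (take i x @ a # drop i x) (take i y @ b # drop i y) =
    take i (map2 h x y) @ h a b # drop i (map2 h x y)"
  using assms by (simp add: take_map drop_map take_zip drop_zip)

lemma permute_list_map2:
  assumes "p permutes {..<length x}" "length x = length y"
  shows "permute_list p (map2 h x y) = map2 h (permute_list p x) (permute_list p y)"
  using assms by (simp add: permute_list_map permute_list_zip)

text \<open>Expanding (C - P)(C - Q) \<ge> 0 gives C(P + Q) \<le> C^2 + PQ \<le> C(C + D), and C
  cancels unless it is 0, which forces P = Q = 0. This is the core of the one-bit case of the
  Ahlswede-Daykin four functions theorem.\<close>

lemma add_le_add_of_products:
  fixes P Q C D :: real
  assumes "0 \<le> P" "0 \<le> Q" "0 \<le> D" "P \<le> C" "Q \<le> C" "P * Q \<le> C * D"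
  shows "P + Q \<le> C + D"
proof (cases "C = 0")
  case False
  then have "0 < C" using assms by linarith
  have "0 \<le> (C - P) * (C - Q)" using assms by simp
  then have "C * (P + Q) \<le> C * (C + D)" using assms by (simp add: algebra_simps)
  then show ?thesis using \<open>0 < C\<close> by simp
qed (use assms in auto)

lemma lsm_self_dual_add_fictitious:
  assumes "(k, f) \<in> lsm_self_dual" "i \<le> k"
  shows "add_fictitious k i f \<in> lsm_self_dual"
  unfolding add_fictitious_def
proof (rule lsm_self_dualI)
  fix x y :: "bool list" assume x: "length x = Suc k" and y: "length y = Suc k"
  have l: "length (take i z @ drop (Suc i) z) = k" if "length z = Suc k" for z :: "bool list"
    using that assms(2) by simp
  note D = lsm_self_dualD[OF assms(1) l[OF x]]
  show "0 \<le> (\<lambda>x\<in>tuples (Suc k). f (take i x @ drop (Suc i) x)) x"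
    using D(1) x by (simp add: tuples_def)
  show "(\<lambda>x\<in>tuples (Suc k). f (take i x @ drop (Suc i) x)) (map Not x) =
        (\<lambda>x\<in>tuples (Suc k). f (take i x @ drop (Suc i) x)) x"
    using D(2) x by (simp add: tuples_def take_map drop_map)
  show "(\<lambda>x\<in>tuples (Suc k). f (take i x @ drop (Suc i) x)) x *
        (\<lambda>x\<in>tuples (Suc k). f (take i x @ drop (Suc i) x)) y
     \<le> (\<lambda>x\<in>tuples (Suc k). f (take i x @ drop (Suc i) x)) (map2 (\<and>) x y) *
        (\<lambda>x\<in>tuples (Suc k). f (take i x @ drop (Suc i) x)) (map2 (\<or>) x y)"
    using D(3)[OF l[OF y]] x y by (simp add: tuples_def map2_delete del: zip_append)
qed

lemma lsm_self_dual_permute_args: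
  assumes "(k, f) \<in> lsm_self_dual" "p permutes {..<k}"
  shows "permute_args k p f \<in> lsm_self_dual"
  unfolding permute_args_def
proof (rule lsm_self_dualI)
  let ?g = "\<lambda>x\<in>tuples k. f (permute_list p x)"
  fix x y :: "bool list" assume x: "length x = k" and y: "length y = k"
  note D = lsm_self_dualD[OF assms(1), of "permute_list p x"]
  show "0 \<le> ?g x" using D(1) x by (simp add: tuples_def)
  show "?g (map Not x) = ?g x"
    using D(2) x assms(2) by (simp add: tuples_def permute_list_map)
  show "?g x * ?g y \<le> ?g (map2 (\<and>) x y) * ?g (map2 (\<or>) x y)"
    using D(3)[of "permute_list p y"] x y assms(2) by (simp add: tuples_def permute_list_map2)
qed

lemma lsm_self_dual_product:
  assumes f: "(k, f) \<in> lsm_self_dual" and g: "(k, g) \<in> lsm_self_dual"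
  shows "product k f g \<in> lsm_self_dual"
  unfolding product_def
proof (rule lsm_self_dualI)
  fix x y :: "bool list" assume x: "length x = k" and y: "length y = k"
  have "(f x * f y) * (g x * g y) \<le>
      (f (map2 (\<and>) x y) * f (map2 (\<or>) x y)) * (g (map2 (\<and>) x y) * g (map2 (\<or>) x y))"
    using x y by (intro mult_mono lsm_self_dualD(3)[OF f] lsm_self_dualD(3)[OF g] mult_nonneg_nonneg
      lsm_self_dualD(1)[OF f] lsm_self_dualD(1)[OF g]) auto
  then show "(\<lambda>x\<in>tuples k. f x * g x) x * (\<lambda>x\<in>tuples k. f x * g x) y
     \<le> (\<lambda>x\<in>tuples k. f x * g x) (map2 (\<and>) x y) * (\<lambda>x\<in>tuples k. f x * g x) (map2 (\<or>) x y)"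
    using x y by (simp add: tuples_def mult_ac)
qed (simp_all add: tuples_def lsm_self_dualD[OF f] lsm_self_dualD[OF g])

text \<open>Both sides of the inequality for the sums expand into four products. Those with equal
  inserted bits compare termwise. The two mixed ones are bounded by the same product on the right,
  so they must be compared as a pair, through \<open>add_le_add_of_products\<close>.\<close>

lemma lsm_self_dual_sum_out:
  assumes f: "(Suc k, f) \<in> lsm_self_dual" and "i \<le> k"
  shows "sum_out k i f \<in> lsm_self_dual"
  unfolding sum_out_def
proof (rule lsm_self_dualI)
  let ?ins = "\<lambda>b x. take i x @ b # drop i x"
  let ?g = "\<lambda>x\<in>tuples k. \<Sum>b\<in>{False, True}. f (?ins b x)"
  have g: "?g z = f (?ins False z) + f (?ins True z)" if "length z = k" for z
    using that by (simp add: tuples_def)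
  fix x y :: "bool list" assume x: "length x = k" and y: "length y = k"
  have l: "length (?ins b z) = Suc k" if "length z = k" for b and z :: "bool list"
    using that assms(2) by simp
  note nonneg = lsm_self_dualD(1)[OF f l]
  show "0 \<le> ?g x" using nonneg[OF x] g[OF x] by simp
  \<comment> \<open>Complementing the whole tuple flips the inserted bit too, so the two summands
    trade places.\<close>
  have "?ins (\<not> b) (map Not x) = map Not (?ins b x)" for b
    by (simp add: take_map drop_map)
  then have dual: "f (?ins (\<not> b) (map Not x)) = f (?ins b x)" for b
    using lsm_self_dualD(2)[OF f l[OF x]] by simp
  show "?g (map Not x) = ?g x"
    using dual[of False] dual[of True] g[of x] g[of "map Not x"] x by simp
  define m where "m = map2 (\<and>) x y"
  define j where "j = map2 (\<or>) x y"
  have m: "length m = k" and j: "length j = k" using x y by (simp_all add: m_def j_def)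
  have lsm: "f (?ins a x) * f (?ins b y) \<le> f (?ins (a \<and> b) m) * f (?ins (a \<or> b) j)" for a b
    using lsm_self_dualD(3)[OF f l[OF x, of a] l[OF y, of b]] x y
    by (simp add: map2_insert m_def j_def del: zip_append)
  note n = nonneg[OF x] nonneg[OF y] nonneg[OF m] nonneg[OF j]
  have FF: "f (?ins False x) * f (?ins False y) \<le> f (?ins False m) * f (?ins False j)"
    using lsm[of False False] by simp
  have TT: "f (?ins True x) * f (?ins True y) \<le> f (?ins True m) * f (?ins True j)"
    using lsm[of True True] by simp
  have FT: "f (?ins False x) * f (?ins True y) \<le> f (?ins False m) * f (?ins True j)"
    using lsm[of False True] by simp
  have TF: "f (?ins True x) * f (?ins False y) \<le> f (?ins False m) * f (?ins True j)"
    using lsm[of True False] by simp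
  \<comment> \<open>The product of the two mixed terms is also the product of the terms in
    \<open>FF\<close> and \<open>TT\<close>, which supplies the hypothesis P * Q \<le> C *
    D.\<close>
  have "(f (?ins False x) * f (?ins True y)) * (f (?ins True x) * f (?ins False y))
      \<le> (f (?ins False m) * f (?ins True j)) * (f (?ins True m) * f (?ins False j))"
    using mult_mono[OF FF TT] n by (simp add: mult_ac)
  from add_le_add_of_products[OF _ _ _ FT TF this]
  have "f (?ins False x) * f (?ins True y) + f (?ins True x) * f (?ins False y)
      \<le> f (?ins False m) * f (?ins True j) + f (?ins True m) * f (?ins False j)"
    using n by simp
  then show "?g x * ?g y \<le> ?g (map2 (\<and>) x y) * ?g (map2 (\<or>) x y)"
    unfolding m_def[symmetric] j_def[symmetric] g[OF x] g[OF y] g[OF m] g[OF j]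
    using FF TT by (simp add: algebra_simps)
qed

section \<open>The generators\<close>

text \<open>A constant tuple is comparable with every tuple, so if \<open>x\<close> or
  \<open>y\<close> is constant, meet and join are just \<open>x\<close> and \<open>y\<close> again
  and equality holds. Otherwise the left side is c^2, and c is the least value.\<close>

lemma lsm_self_dual_Ising:
  assumes "0 \<le> c" "c \<le> 1"
  shows "Ising k c \<in> lsm_self_dual"
  unfolding Ising_def
proof (rule lsm_self_dualI)
  let ?g = "\<lambda>x\<in>tuples k. if x = replicate k False \<or> x = replicate k True then 1 else c"
  fix x y :: "bool list" assume x: "length x = k" and y: "length y = k"
  show "0 \<le> ?g x" using assms x by (simp add: tuples_def)
  have "map Not x = replicate k b \<longleftrightarrow> x = replicate k (\<not> b)" for b
    using x by (auto simp: list_eq_iff_nth_eq)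
  then show "?g (map Not x) = ?g x" using x by (auto simp: tuples_def)
  have bounds: "c \<le> ?g z" "?g z \<le> 1" if "length z = k" for z
    using that assms by (simp_all add: tuples_def)
  have m: "length (map2 (\<and>) x y) = k" and j: "length (map2 (\<or>) x y) = k"
    using x y by simp_all
  have const: "z = replicate k False \<or> z = replicate k True" if "?g z \<noteq> c" "length z = k" for z
    using that by (auto simp: tuples_def split: if_splits)
  have meet_join: "{map2 (\<and>) x y, map2 (\<or>) x y} = {x, y}"
    if "x \<in> {replicate k False, replicate k True} \<or> y \<in> {replicate k False, replicate k True}"
  proof -
    have "map2 (\<and>) x y = x \<and> map2 (\<or>) x y = y \<or> map2 (\<and>) x y = y \<and> map2 (\<or>) x y = x"
      using that x y by (auto simp: list_eq_iff_nth_eq)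
    then show ?thesis by auto
  qed
  show "?g x * ?g y \<le> ?g (map2 (\<and>) x y) * ?g (map2 (\<or>) x y)"
  proof (cases "?g x = c \<and> ?g y = c")
    case True
    then show ?thesis
      using mult_mono[OF bounds(1)[OF m] bounds(1)[OF j]] bounds(1)[OF m] assms(1) by simp
  next
    case False
    then have "x \<in> {replicate k False, replicate k True} \<or> y \<in> {replicate k False, replicate k True}"
      using const x y by blast
    from meet_join[OF this]
    have "?g (map2 (\<and>) x y) * ?g (map2 (\<or>) x y) = ?g x * ?g y"
      unfolding doubleton_eq_iff by (elim disjE conjE) (simp_all only: mult.commute)
    then show ?thesis by simp
  qed
qed

text \<open>Reduces the \<open>EQ\<close> case of the closure inductions to the Ising case.\<close>

lemma EQ_eq_Ising: "EQ = Ising 2 0"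
proof -
  have "x ! 0 = x ! 1 \<longleftrightarrow> x = replicate 2 False \<or> x = replicate 2 True" if "x \<in> tuples 2" for x
    using that by (auto simp: tuples_def length_Suc_conv numeral_2_eq_2)
  then show ?thesis
    by (simp add: EQ_def Ising_def cong: restrict_cong)
qed

text \<open>The empty tuple is its own complement, meet and join, so only nonnegativity has
  content.\<close>

lemma lsm_self_dual_Bk_0: "Bk 0 \<subseteq> lsm_self_dual"
  by (auto simp: Bk_def tuples_def PiE_def Pi_def intro!: lsm_self_dualI)

section \<open>Clones and limits\<close>

lemma clone_subset_lsm_self_dual:
  assumes "F \<subseteq> lsm_self_dual"
  shows "clone F \<subseteq> lsm_self_dual"
proof
  fix f assume "f \<in> clone F"
  then show "f \<in> lsm_self_dual"
    by induction (use assms in \<open>auto simp: EQ_eq_Ising lsm_self_dual_Ising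
      lsm_self_dual_add_fictitious lsm_self_dual_permute_args lsm_self_dual_product
      lsm_self_dual_sum_out\<close>)
qed

lemma finite_tuples: "finite (tuples k)"
  using finite_lists_length_eq[of "UNIV :: bool set" k] by (simp add: tuples_def)

text \<open>The class is cut out by equations and weak inequalities between continuous expressions
  in the values, hence is closed under pointwise limits; the approximants lie in it because they
  come from a clone over it.\<close>

lemma lsm_self_dual_limit:
  assumes "is_limit lsm_self_dual k f"
  shows "(k, f) \<in> lsm_self_dual"
proof -
  obtain S where S: "S \<subseteq> lsm_self_dual"
    and approx: "\<forall>\<epsilon>>0. \<exists>g. (k, g) \<in> clone S \<and> Max ((\<lambda>x. \<bar>f x - g x\<bar>) ` tuples k) < \<epsilon>"
    using assms unfolding is_limit_def by blast
  have "\<forall>n. \<exists>g. (k, g) \<in> clone S \<and> Max ((\<lambda>x. \<bar>f x - g x\<bar>) ` tuples k) < 1 / real (Suc n)"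
    using approx by simp
  then obtain g where g: "\<And>n. (k, g n) \<in> clone S"
    and close: "\<And>n. Max ((\<lambda>x. \<bar>f x - g n x\<bar>) ` tuples k) < 1 / real (Suc n)"
    by metis
  have inv: "(k, g n) \<in> lsm_self_dual" for n
    using g clone_subset_lsm_self_dual[OF S] by blast
  have lim: "(\<lambda>n. g n x) \<longlonglongrightarrow> f x" if "length x = k" for x
  proof (rule LIMSEQ_I)
    fix r :: real assume "0 < r"
    then obtain N where N: "1 / real (Suc N) < r"
      using nat_approx_posE by blast
    have "norm (g n x - f x) < r" if "n \<ge> N" for n
    proof -
      have "\<bar>f x - g n x\<bar> \<le> Max ((\<lambda>x. \<bar>f x - g n x\<bar>) ` tuples k)"
        using \<open>length x = k\<close> by (intro Max_ge) (auto simp: finite_tuples, simp add: tuples_def)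
      also have "\<dots> < 1 / real (Suc n)" by (rule close)
      also have "\<dots> \<le> 1 / real (Suc N)" using that by (simp add: frac_le)
      finally show ?thesis using N by (simp add: abs_minus_commute)
    qed
    then show "\<exists>N. \<forall>n\<ge>N. norm (g n x - f x) < r" by blast
  qed
  show ?thesis
  proof (rule lsm_self_dualI)
    fix x y :: "bool list" assume x: "length x = k" and y: "length y = k"
    show "0 \<le> f x"
      using lsm_self_dualD(1)[OF inv x] by (intro LIMSEQ_le_const[OF lim[OF x]]) auto
    \<comment> \<open>Self-duality of each \<open>g n\<close> makes this the same sequence that
      converges to \<open>f x\<close>.\<close>
    have "(\<lambda>n. g n x) \<longlonglongrightarrow> f (map Not x)"
      using lim[of "map Not x"] x lsm_self_dualD(2)[OF inv x] by simp
    then show "f (map Not x) = f x"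
      using lim[OF x] LIMSEQ_unique by blast
    show "f x * f y \<le> f (map2 (\<and>) x y) * f (map2 (\<or>) x y)"
    proof (rule LIMSEQ_le)
      show "(\<lambda>n. g n x * g n y) \<longlonglongrightarrow> f x * f y"
        by (intro tendsto_mult lim x y)
      show "(\<lambda>n. g n (map2 (\<and>) x y) * g n (map2 (\<or>) x y)) \<longlonglongrightarrow>
          f (map2 (\<and>) x y) * f (map2 (\<or>) x y)"
        by (intro tendsto_mult lim) (use x y in auto)
    qed (use lsm_self_dualD(3)[OF inv x y] in blast)
  qed
qed

lemma omega_clone_subset_lsm_self_dual:
  assumes "F \<subseteq> lsm_self_dual"
  shows "omega_clone F \<subseteq> lsm_self_dual"
proof
  fix f assume "f \<in> omega_clone F"
  then show "f \<in> lsm_self_dual"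
  proof induction
    case (limit k f)
    \<comment> \<open>The induction hypothesis concerns limits of those members of
      \<open>omega_clone F\<close> that lie in \<open>lsm_self_dual\<close>; monotonicity of
      \<open>is_limit\<close> enlarges this set to the whole class.\<close>
    then show ?case by (intro lsm_self_dual_limit) (erule is_limit_mono[rotated], blast)
  qed (use assms in \<open>auto simp: EQ_eq_Ising lsm_self_dual_Ising
      lsm_self_dual_add_fictitious lsm_self_dual_permute_args lsm_self_dual_product
      lsm_self_dual_sum_out\<close>)
qed

lemma omega_clone_mono:
  assumes "F \<subseteq> G"
  shows "omega_clone F \<subseteq> omega_clone G"
proof
  fix f assume "f \<in> omega_clone F"
  then show "f \<in> omega_clone G"
  proof induction
    case (limit k f)
    then show ?case by (intro omega_clone.limit) (erule is_limit_mono[rotated], blast)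
  qed (use assms in \<open>auto intro: omega_clone.intros\<close>)
qed

section \<open>Ternary functions as Ising triangles\<close>

text \<open>For positive values the weights are square roots of ratios, and each inequality in
  \<open>lsm\<close> says that one of them is at most 1. The degenerate cases, where these ratios
  break down, are solved by hand.\<close>

lemma three_edge_weights:
  fixes a b c d :: real
  assumes nonneg: "0 \<le> b" "0 \<le> c" "0 \<le> d" and le: "b \<le> a" "c \<le> a" "d \<le> a"
    and lsm: "b * c \<le> a * d" "b * d \<le> a * c" "c * d \<le> a * b"
  shows "\<exists>u\<in>{0..1}. \<exists>v\<in>{0..1}. \<exists>w\<in>{0..1}. b = a * (u * v) \<and> c = a * (u * w) \<and> d = a * (v * w)"
proof -
  \<comment> \<open>With a > 0, one zero among b, c, d makes the right side of an inequality in
    \<open>lsm\<close> vanish and so forces a second zero. At most one value then survives; it is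
    realised by weights 1, its ratio to a, and 0.\<close>
  consider "a = 0" | "0 < a" "0 < b" "0 < c" "0 < d"
    | "0 < a" "c = 0" "d = 0" | "0 < a" "b = 0" "d = 0" | "0 < a" "b = 0" "c = 0"
  proof -
    have "b = 0 \<or> c = 0" if "d = 0" using that lsm nonneg by (simp add: mult_le_0_iff) linarith
    moreover have "b = 0 \<or> d = 0" if "c = 0" using that lsm nonneg by (simp add: mult_le_0_iff) linarith
    moreover have "c = 0 \<or> d = 0" if "b = 0" using that lsm nonneg by (simp add: mult_le_0_iff) linarith
    ultimately show thesis using that nonneg le by (smt (verit))
  qed
  then show ?thesis
  proof cases
    case 1
    then show ?thesis using nonneg le by (intro bexI[of _ 0]) auto
  next
    case 2
    have "sqrt (b * c / (a * d)) * sqrt (b * d / (a * c)) = sqrt ((b / a)\<^sup>2)"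
      "sqrt (b * c / (a * d)) * sqrt (c * d / (a * b)) = sqrt ((c / a)\<^sup>2)"
      "sqrt (b * d / (a * c)) * sqrt (c * d / (a * b)) = sqrt ((d / a)\<^sup>2)"
      unfolding real_sqrt_mult[symmetric] using 2
      by (auto simp: power2_eq_square field_simps)
    then show ?thesis using 2 lsm
      by (intro bexI[of _ "sqrt (b * c / (a * d))"] bexI[of _ "sqrt (b * d / (a * c))"]
          bexI[of _ "sqrt (c * d / (a * b))"]) auto
  next
    case 3
    then show ?thesis using nonneg le
      by (intro bexI[of _ 1] bexI[of _ "b / a"] bexI[of _ 0]) auto
  next
    case 4
    then show ?thesis using nonneg le
      by (intro bexI[of _ "c / a"] bexI[of _ 0] bexI[of _ 1]) auto
  next
    case 5
    then show ?thesis using nonneg le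
      by (intro bexI[of _ 0] bexI[of _ "d / a"] bexI[of _ 1]) auto
  qed
qed

lemma tuples_3: "x \<in> tuples 3 \<longleftrightarrow> (\<exists>p q r. x = [p, q, r])"
  by (auto simp: tuples_def length_Suc_conv numeral_3_eq_3)

text \<open>The arguments are the vertices of a triangle with weights u, v, w on the edges 01, 02,
  12; an edge contributes its weight when its ends disagree.\<close>

lemma I_ferro_triangle:
  assumes "0 \<le> a" and "u \<in> {0..1}" "v \<in> {0..1}" "w \<in> {0..1}"
  shows "(3, \<lambda>x\<in>tuples 3. a * ((if x ! 0 = x ! 1 then 1 else u) *
    ((if x ! 0 = x ! 2 then 1 else v) * (if x ! 1 = x ! 2 then 1 else w)))) \<in> I_ferro"
proof -
  \<comment> \<open>Here \<open>l\<close> is the vertex off the edge: deleting position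
    \<open>l\<close> leaves arguments \<open>i\<close> and \<open>j\<close> in order.\<close>
  have edge: "(3, \<lambda>x\<in>tuples 3. if x ! i = x ! j then 1 else c) \<in> I_ferro"
    if c: "c \<in> {0..1}" and ij: "(i, j, l) \<in> {(0, 1, 2), (0, 2, 1), (1, 2, 0)}"
    for c :: real and i j l :: nat
  proof -
    define h where "h = (\<lambda>x\<in>tuples 2. if x = replicate 2 False \<or> x = replicate 2 True then 1 else c)"
    have "(2, h) \<in> I_ferro"
      unfolding I_ferro_def h_def Ising_def[symmetric] using c by (intro omega_clone.base) auto
    then have fict: "add_fictitious 2 l h \<in> I_ferro"
      unfolding I_ferro_def by (rule omega_clone.fictitious) (use ij in auto)
    have "(\<lambda>x\<in>tuples 3. h (take l x @ drop (Suc l) x)) =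
        (\<lambda>x\<in>tuples 3. if x ! i = x ! j then 1 else c)"
    proof (rule restrict_ext)
      fix x :: "bool list" assume "x \<in> tuples 3"
      then obtain p q r where "x = [p, q, r]" by (auto simp: tuples_3)
      then show "h (take l x @ drop (Suc l) x) = (if x ! i = x ! j then 1 else c)"
        using ij by (auto simp: h_def tuples_def numeral_2_eq_2)
    qed
    then have "add_fictitious 2 l h = (3, \<lambda>x\<in>tuples 3. if x ! i = x ! j then 1 else c)"
      by (simp add: add_fictitious_def)
    then show ?thesis using fict by simp
  qed
  have const: "(3, \<lambda>x\<in>tuples 3. a) \<in> I_ferro"
  proof -
    \<comment> \<open>The scalar starts as a nullary generator and gains one fictitious argument at
      a time.\<close>
    have "(k, \<lambda>x\<in>tuples k. a) \<in> I_ferro" for k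
    proof (induction k)
      case 0
      show ?case unfolding I_ferro_def using assms(1)
        by (intro omega_clone.base) (auto simp: Bk_def)
    next
      case (Suc k)
      then have "add_fictitious k 0 (\<lambda>x\<in>tuples k. a) \<in> I_ferro"
        unfolding I_ferro_def by (rule omega_clone.fictitious) simp
      also have "add_fictitious k 0 (\<lambda>x\<in>tuples k. a) = (Suc k, \<lambda>x\<in>tuples (Suc k). a)"
        by (auto simp: add_fictitious_def tuples_def)
      finally show ?case .
    qed
    then show ?thesis .
  qed
  have prod: "(3, \<lambda>x\<in>tuples 3. f x * g x) \<in> I_ferro"
    if "(3, \<lambda>x\<in>tuples 3. f x) \<in> I_ferro" "(3, \<lambda>x\<in>tuples 3. g x) \<in> I_ferro" for f g
    using omega_clone.product[OF that[unfolded I_ferro_def]]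
    by (simp add: product_def I_ferro_def cong: restrict_cong)
  show ?thesis
    by (intro prod const edge[of u 0 1 2] edge[of v 0 2 1] edge[of w 1 2 0] assms) auto
qed

lemma lsm_self_dual_ternary_in_I_ferro:
  assumes f: "(3, f) \<in> lsm_self_dual" and ext: "(3, f) \<in> Bk 3"
  shows "(3, f) \<in> I_ferro"
proof -
  note D = lsm_self_dualD[OF f]
  define a b c d where "a = f [False, False, False]" and "b = f [True, False, False]"
    and "c = f [False, True, False]" and "d = f [False, False, True]"
  note abcd = a_def b_def c_def d_def
  have dual: "f [True, True, True] = a" "f [False, True, True] = b"
    "f [True, False, True] = c" "f [True, True, False] = d"
    using D(2)[of "[False, False, False]"] D(2)[of "[True, False, False]"]
      D(2)[of "[False, True, False]"] D(2)[of "[False, False, True]"] by (simp_all add: abcd)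
  have nonneg: "0 \<le> a" "0 \<le> b" "0 \<le> c" "0 \<le> d" using D(1) by (simp_all add: abcd)
  \<comment> \<open>Log-supermodularity for a tuple and its complement bounds every value by \<open>a\<close>.\<close>
  have "b\<^sup>2 \<le> a\<^sup>2" "c\<^sup>2 \<le> a\<^sup>2" "d\<^sup>2 \<le> a\<^sup>2"
    using D(3)[of "[True, False, False]" "[False, True, True]"]
      D(3)[of "[False, True, False]" "[True, False, True]"]
      D(3)[of "[False, False, True]" "[True, True, False]"]
    by (simp_all add: dual abcd[symmetric] power2_eq_square)
  then have le: "b \<le> a" "c \<le> a" "d \<le> a" using nonneg by (auto intro: power2_le_imp_le)
  \<comment> \<open>Two tuples with a single 1 meet in the zero tuple, and their join is the
    complement of the third such tuple, so by \<open>dual\<close> it carries the remaining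
    value.\<close>
  have lsm: "b * c \<le> a * d" "b * d \<le> a * c" "c * d \<le> a * b"
    using D(3)[of "[True, False, False]" "[False, True, False]"]
      D(3)[of "[True, False, False]" "[False, False, True]"]
      D(3)[of "[False, True, False]" "[False, False, True]"]
    by (simp_all add: dual abcd[symmetric])
  obtain u v w where uvw: "u \<in> {0..1}" "v \<in> {0..1}" "w \<in> {0..1}"
    and eqs: "b = a * (u * v)" "c = a * (u * w)" "d = a * (v * w)"
    using three_edge_weights[OF nonneg(2-4) le lsm] by blast
  have "f = (\<lambda>x\<in>tuples 3. a * ((if x ! 0 = x ! 1 then 1 else u) *
    ((if x ! 0 = x ! 2 then 1 else v) * (if x ! 1 = x ! 2 then 1 else w))))" (is "_ = restrict ?h _")
  proof (rule extensionalityI)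
    show "f \<in> extensional (tuples 3)" using ext by (simp add: Bk_def PiE_def)
    fix x :: "bool list" assume x: "x \<in> tuples 3"
    then obtain p q r where pqr: "x = [p, q, r]" by (auto simp: tuples_3)
    have "f x = ?h x"
      \<comment> \<open>In a nonconstant triple one argument disagrees with both others, so exactly
        the two edges at that vertex contribute, matching \<open>eqs\<close>.\<close>
      unfolding pqr by (cases p; cases q; cases r) (simp_all add: dual abcd[symmetric] eqs)
    then show "f x = restrict ?h (tuples 3) x" using x by simp
  qed simp
  then show ?thesis using I_ferro_triangle[OF nonneg(1) uvw] by simp
qed

theorem theorem12p2: "ternary_part H_ferro = ternary_part I_ferro"
proof
  have "H_ferro \<subseteq> lsm_self_dual"
    unfolding H_ferro_def using lsm_self_dual_Bk_0
    by (intro omega_clone_subset_lsm_self_dual) (auto simp: lsm_self_dual_Ising)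
  then show "ternary_part H_ferro \<subseteq> ternary_part I_ferro"
    unfolding ternary_part_def using lsm_self_dual_ternary_in_I_ferro
    by (auto simp: Bk_def)
  show "ternary_part I_ferro \<subseteq> ternary_part H_ferro"
    unfolding ternary_part_def I_ferro_def H_ferro_def
    by (intro Int_mono omega_clone_mono) auto
qed

end
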